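(* Let $\kappa\ge 2$ be an integer, let $\Sigma\subseteq\{1,\dots,\kappa\}$ be the set of strong features, with cardinality $\varsigma>1$, and let $\sigma^2>0$, $L$ and $\mathrm{tf}$ be the variance bound, the Lipschitz constant and the target function described in the context. Let $(k_n)_{n\ge1}$ be any sequence of positive integers (the numbers of leaf nodes) with $k_n\to\infty$ and $k_n/n\to 0$ as $n\to\infty$. For each $n$ let $(\delta_{n,j})_{j\in\Sigma}$ be real numbers with $\sum_{j\in\Sigma}\delta_{n,j}\le\kappa$ and $$1<\delta_{n,j}<\frac{\kappa}{2}\qquad\text{for all } n \text{ and all } j\in\Sigma .$$ Then $\delta$-targeted sampling with factors $\delta_{n,j}$ yields a strictly smaller non-asymptotic upper bound on the mean squared error than uniform sampling. That is, for every $n\ge 1$, $$B_n\big((\xi^{\mathrm{ts}}_{n,j})_{j\in\Sigma}\big)<B_n\big((\xi^{\mathrm{us}}_{n,j})_{j\in\Sigma}\big),$$ where $B_n$ is the mean squared error bound defined in the context (with the same $k_n$ for both schemes), and $\xi^{\mathrm{us}}_{n,j}$ and $\xi^{\mathrm{ts}}_{n,j}$ are the deviations, defined in the context, associated with uniform sampling and with $\delta$-targeted sampling respectively.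
   Context: Setting. $\mathbf X$ is a random vector uniformly distributed on $[0,1]^\kappa$, and $Y$ is a square-integrable real response. The target function is $\mathrm{tf}(\mathbf x)=\mathbb E[Y\mid\mathbf X=\mathbf x]$. The set $\Sigma$ of strong features is such that $\mathrm{tf}(\mathbf x)=\mathrm{tf}^\star(\mathbf x_\Sigma)$ almost surely, where $\mathbf x_\Sigma$ is the restriction of $\mathbf x$ to the coordinates in $\Sigma$ and $\mathrm{tf}^\star:[0,1]^\varsigma\to\mathbb R$ is $L$-Lipschitz (so $\mathrm{tf}$ is bounded). Moreover $\mathrm{var}[Y\mid\mathbf X=\mathbf x]\le\sigma^2$ for all $\mathbf x\in[0,1]^\kappa$, where $\sigma^2$ is a positive constant. A random forest estimator $\overline{\mathrm{tf}}_n$ is the average, conditional on a training sample of size $n$, over infinitely many independently randomized trees, each with $k_n$ leaf nodes. At every node the split feature is chosen independently, feature $j\in\{1,\dots,\kappa\}$ having probability $\pi_{n,j}$. Sampling schemes. - Uniform sampling: $\pi_{n,j}=1/\kappa$ for all $j\in\{1,\dots,\kappa\}$. - $\delta$-targeted sampling: $\pi_{n,j}=\delta_{n,j}/\kappa$ for $j\in\Sigma$, and $\pi_{n,j}=\big(1-\sum_{i\in\Sigma}\delta_{n,i}/\kappa\big)/(\kappa-\varsigma)$ for $j\notin\Sigma$, where $\sum_{j\in\Sigma}\delta_{n,j}\le\kappa$, $\delta_{n,j}\ge1$ for all $j\in\Sigma$, and $\delta_{n,j}>1$ for some $j\in\Sigma$. Deviations. For $j\in\Sigma$, the deviation $\xi_{n,j}$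 is defined by $\pi_{n,j}=\frac1\varsigma(1+\xi_{n,j})$. Hence for $j\in\Sigma$, $$\xi^{\mathrm{us}}_{n,j}=\frac{\varsigma-\kappa}{\kappa}\ \text{ (uniform)},\qquad \xi^{\mathrm{ts}}_{n,j}=\frac{\delta_{n,j}\,\varsigma-\kappa}{\kappa}\ \text{ ($\delta$-targeted)}.$$ The mean squared error bound. For a family $(\xi_{n,j})_{j\in\Sigma}$ put $$\varpi_n=\min_{j\in\Sigma}\xi_{n,j},\qquad \xi_n=\prod_{j\in\Sigma}\left[(1+\xi_{n,j})^{-1}\left(1-\frac{\xi_{n,j}}{\varsigma-1}\right)^{-1}\right]^{1/(2\kappa)}-1,$$ $$\Xi_n=\frac{288}{\pi}\left(\frac{\pi\log2}{16}\right)^{\varsigma/(2\kappa)}\sigma^2\left(\frac{\varsigma^2}{\varsigma-1}\right)^{\varsigma/(2\kappa)}(1+\xi_n)+2e^{-1}\sup_{\mathbf x\in[0,1]^\kappa}\mathrm{tf}^2(\mathbf x),$$ where $\pi$ without indices is the usual constant and $\log$ is the natural logarithm, and $$B_n\big((\xi_{n,j})_{j\in\Sigma}\big)=\Xi_n\,\frac{k_n}{n}+\frac{2\varsigma L^2}{k_n^{\frac{0.75}{\varsigma\log 2}(1+\varpi_n)}} .$$ The quantity $B_n$ is the (known) non-asymptotic upper bound for the mean squared error $\mathbb E[\overline{\mathrm{tf}}_n(\mathbf X)-\mathrm{tf}(\mathbf X)]^2$ of the forest with selection probabilities $\pi_{n,j}=\frac1\varsigma(1+\xi_{n,j})$, $j\in\Sigma$.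 The comparison of the two sampling schemes is a comparison of the corresponding values of $B_n$. *)

theory Defs
  imports "HOL-Probability.Probability"
begin

text \<open>
  Points of the \<open>\<kappa>\<close>-dimensional feature space are functions \<open>nat \<Rightarrow> real\<close> that are extensional on
  \<open>{1..\<kappa>}\<close>; the restriction of \<open>x\<close> to the coordinates in \<open>\<Sigma>\<close> is \<open>restrict x \<Sigma>\<close>, and the cube
  \<open>[0,1]\<close> to the power \<open>card \<Sigma>\<close> is identified with the cube indexed by \<open>\<Sigma>\<close> itself.
\<close>

definition unit_cube :: "nat set \<Rightarrow> (nat \<Rightarrow> real) set" where
  "unit_cube I = (\<Pi>\<^sub>E i\<in>I. {0..1})"

definition uniform_cube :: "nat set \<Rightarrow> (nat \<Rightarrow> real) measure" where
  "uniform_cube I = uniform_measure (\<Pi>\<^sub>M i\<in>I. lborel) (unit_cube I)"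

text \<open>Lipschitz continuity on the cube with respect to the Euclidean distance.\<close>

definition cube_lipschitz :: "real \<Rightarrow> nat set \<Rightarrow> ((nat \<Rightarrow> real) \<Rightarrow> real) \<Rightarrow> bool" where
  "cube_lipschitz L I f \<longleftrightarrow> 0 \<le> L \<and>
     (\<forall>x\<in>unit_cube I. \<forall>y\<in>unit_cube I. \<bar>f x - f y\<bar> \<le> L * L2_set (\<lambda>i. x i - y i) I)"

text \<open>
  \<open>g\<close> is a version of \<open>x \<mapsto> E[Z | X = x]\<close>: it is measurable, and \<open>g \<circ> X\<close> is a version of the
  conditional expectation of \<open>Z\<close> given the sigma-algebra generated by \<open>X\<close>.
\<close>

definition cond_exp_version ::
  "'w measure \<Rightarrow> nat set \<Rightarrow> ('w \<Rightarrow> nat \<Rightarrow> real) \<Rightarrow> ('w \<Rightarrow> real) \<Rightarrow> ((nat \<Rightarrow> real) \<Rightarrow> real) \<Rightarrow> bool" where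
  "cond_exp_version M I X Z g \<longleftrightarrow>
     g \<in> borel_measurable (\<Pi>\<^sub>M i\<in>I. borel) \<and>
     (AE \<omega> in M. g (X \<omega>) =
        real_cond_exp M (vimage_algebra (space M) X (\<Pi>\<^sub>M i\<in>I. borel)) Z \<omega>)"

definition uniform_sampling :: "nat \<Rightarrow> nat \<Rightarrow> real" where
  "uniform_sampling \<kappa> j = 1 / real \<kappa>"

definition targeted_sampling :: "nat \<Rightarrow> nat set \<Rightarrow> (nat \<Rightarrow> real) \<Rightarrow> nat \<Rightarrow> real" where
  "targeted_sampling \<kappa> \<Sigma> \<delta> j =
     (if j \<in> \<Sigma> then \<delta> j / real \<kappa>
      else (1 - (\<Sum>i\<in>\<Sigma>. \<delta> i / real \<kappa>)) / (real \<kappa> - real (card \<Sigma>)))"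

definition deviation :: "nat set \<Rightarrow> (nat \<Rightarrow> real) \<Rightarrow> nat \<Rightarrow> real" where
  "deviation \<Sigma> p j = real (card \<Sigma>) * p j - 1"

lemma deviation_iff:
  assumes "card \<Sigma> > 0"
  shows "deviation \<Sigma> p j = \<xi> \<longleftrightarrow> p j = 1 / real (card \<Sigma>) * (1 + \<xi>)"
  using assms by (auto simp: deviation_def field_simps)

lemma deviation_uniform:
  assumes "\<kappa> > 0"
  shows "deviation \<Sigma> (uniform_sampling \<kappa>) j = (real (card \<Sigma>) - real \<kappa>) / real \<kappa>"
  using assms by (simp add: deviation_def uniform_sampling_def field_simps)

lemma deviation_targeted:
  assumes "\<kappa> > 0" "j \<in> \<Sigma>"
  shows "deviation \<Sigma> (targeted_sampling \<kappa> \<Sigma> \<delta>) j =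
           (\<delta> j * real (card \<Sigma>) - real \<kappa>) / real \<kappa>"
  using assms by (simp add: deviation_def targeted_sampling_def field_simps)

definition xi_total :: "nat \<Rightarrow> nat set \<Rightarrow> (nat \<Rightarrow> real) \<Rightarrow> real" where
  "xi_total \<kappa> \<Sigma> \<xi> =
     (\<Prod>j\<in>\<Sigma>. (inverse (1 + \<xi> j) * inverse (1 - \<xi> j / (real (card \<Sigma>) - 1)))
               powr (1 / (2 * real \<kappa>))) - 1"

definition variance_factor ::
  "nat \<Rightarrow> nat set \<Rightarrow> real \<Rightarrow> ((nat \<Rightarrow> real) \<Rightarrow> real) \<Rightarrow> (nat \<Rightarrow> real) \<Rightarrow> real" where
  "variance_factor \<kappa> \<Sigma> \<sigma> tf \<xi> =
     (let s = real (card \<Sigma>) in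
       288 / pi * (pi * ln 2 / 16) powr (s / (2 * real \<kappa>)) * \<sigma>\<^sup>2
         * (s\<^sup>2 / (s - 1)) powr (s / (2 * real \<kappa>)) * (1 + xi_total \<kappa> \<Sigma> \<xi>)
       + 2 * exp (- 1) * (SUP x\<in>unit_cube {1..\<kappa>}. (tf x)\<^sup>2))"

text \<open>
  The upper bound for the mean squared error of a forest with \<open>k\<close> leaf nodes per tree, sample
  size \<open>n\<close>, and deviations \<open>\<xi> j\<close> for \<open>j \<in> \<Sigma>\<close>.
\<close>

definition mse_bound ::
  "nat \<Rightarrow> nat set \<Rightarrow> real \<Rightarrow> real \<Rightarrow> ((nat \<Rightarrow> real) \<Rightarrow> real) \<Rightarrow> nat \<Rightarrow> nat \<Rightarrow> (nat \<Rightarrow> real) \<Rightarrow> real" where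
  "mse_bound \<kappa> \<Sigma> \<sigma> L tf k n \<xi> =
     variance_factor \<kappa> \<Sigma> \<sigma> tf \<xi> * (real k / real n)
     + 2 * real (card \<Sigma>) * L\<^sup>2
       / real k powr (0.75 / (real (card \<Sigma>) * ln 2) * (1 + Min (\<xi> ` \<Sigma>)))"

end

theory Submission
  imports Defs
begin

text \<open>
  With \<open>1 + \<xi> = s p\<close> the factor \<open>(1 + \<xi>) (1 - \<xi> / (s - 1))\<close> equals \<open>s\<^sup>2 p (1 - p) / (s - 1)\<close>, and
  \<open>p (1 - p)\<close> is strictly increasing on \<open>[0, 1/2]\<close>.  The assumptions on \<open>\<delta>\<close> say that targeting
  raises every strong selection probability strictly while keeping it below \<open>1/2\<close>; this
  shrinks the variance term, and the bias term can only shrink since \<open>k \<ge> 1\<close> and the minimal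
  deviation grows.
\<close>

text \<open>With \<open>s = card \<Sigma>\<close>, the second bracket is
  \<open>s * (1 - p j) / (s - 1)\<close>. The cases \<open>p j = 0\<close> and
  \<open>p j = 1\<close> are covered by \<open>inverse 0 = 0\<close>, which makes both sides
  zero.\<close>

lemma deviation_factor:
  assumes "card \<Sigma> > 1"
  shows "inverse (1 + deviation \<Sigma> p j) * inverse (1 - deviation \<Sigma> p j / (real (card \<Sigma>) - 1))
    = (real (card \<Sigma>) - 1) / ((real (card \<Sigma>))\<^sup>2 * (p j * (1 - p j)))"
proof -
  define s where "s = real (card \<Sigma>)"
  have s: "s > 1" using assms by (simp add: s_def)
  have "1 - (s * p j - 1) / (s - 1) = s * (1 - p j) / (s - 1)"
    using s by (simp add: field_simps)
  then have "inverse (1 - (s * p j - 1) / (s - 1)) = (s - 1) / (s * (1 - p j))"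
    by simp
  then show ?thesis
    by (simp add: deviation_def s_def[symmetric] power2_eq_square divide_inverse mult_ac)
qed

lemma mult_one_minus_strict_mono:
  fixes p q :: real
  assumes "q < p" "p \<le> 1/2"
  shows "q * (1 - q) < p * (1 - p)"
proof -
  \<comment> \<open>This product is exactly \<open>p * (1 - p) - q * (1 - q)\<close>; its second
    factor is positive because \<open>q < p\<close> and \<open>p \<le> 1/2\<close> give
    \<open>p + q < 1\<close>.\<close>
  have "0 < (p - q) * (1 - p - q)"
    using assms by (intro mult_pos_pos) auto
  then show ?thesis by (simp add: algebra_simps)
qed

text \<open>Each factor is a positive power of a positive constant divided by
  \<open>p j * (1 - p j)\<close>, so it falls strictly as \<open>p j\<close> rises towards
  \<open>1/2\<close>.\<close>

lemma xi_total_strict_antimono: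
  assumes "\<kappa> > 0" "card \<Sigma> > 1"
    and pq: "\<And>j. j \<in> \<Sigma> \<Longrightarrow> 0 < q j \<and> q j < p j \<and> p j \<le> 1/2"
  shows "xi_total \<kappa> \<Sigma> (deviation \<Sigma> p) < xi_total \<kappa> \<Sigma> (deviation \<Sigma> q)"
proof -
  let ?f = "\<lambda>p j. ((real (card \<Sigma>) - 1) / ((real (card \<Sigma>))\<^sup>2 * (p j * (1 - p j))))
                    powr (1 / (2 * real \<kappa>))"
  have less: "0 < ?f p j \<and> ?f p j < ?f q j" if "j \<in> \<Sigma>" for j
  proof -
    define a b where "a = p j * (1 - p j)" and "b = q j * (1 - q j)"
    have "0 < b" "b < a"
      using pq[OF that] unfolding a_def b_def
      by (auto intro!: mult_pos_pos mult_one_minus_strict_mono)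
    let ?s = "real (card \<Sigma>)"
    have "0 < (?s - 1) / (?s\<^sup>2 * a)"
      using \<open>0 < b\<close> \<open>b < a\<close> assms(2) by (intro divide_pos_pos mult_pos_pos) auto
    moreover have "(?s - 1) / (?s\<^sup>2 * a) < (?s - 1) / (?s\<^sup>2 * b)"
      using \<open>0 < b\<close> \<open>b < a\<close> assms(2)
      by (intro divide_strict_left_mono mult_strict_left_mono mult_pos_pos) auto
    ultimately show ?thesis
      using assms(1,2) unfolding a_def b_def
      by (intro conjI powr_less_mono2) auto
  qed
  \<comment> \<open>Infinite sets have \<open>card\<close> equal to 0, so
    \<open>card \<Sigma> > 1\<close> gives finiteness too. Nonemptiness supplies an index where the
    product inequality is strict.\<close>
  have "finite \<Sigma>" "\<Sigma> \<noteq> {}"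
    using assms(2) by (auto simp: card_ge_0_finite)
  then obtain i where "i \<in> \<Sigma>" by blast
  then have "(\<Prod>j\<in>\<Sigma>. ?f p j) < (\<Prod>j\<in>\<Sigma>. ?f q j)"
    using less \<open>finite \<Sigma>\<close>
    by (intro prod_mono_strict[of i]) (blast intro: less_imp_le less_trans)+
  then show ?thesis
    using assms by (simp add: xi_total_def deviation_factor)
qed

lemma variance_factor_strict_mono:
  assumes "card \<Sigma> > 1" "\<sigma>\<^sup>2 > 0" "xi_total \<kappa> \<Sigma> \<xi> < xi_total \<kappa> \<Sigma> \<eta>"
  shows "variance_factor \<kappa> \<Sigma> \<sigma> tf \<xi> < variance_factor \<kappa> \<Sigma> \<sigma> tf \<eta>"
proof -
  let ?s = "real (card \<Sigma>)"
  \<comment> \<open>\<open>?c\<close> is the coefficient of \<open>1 + xi_total\<close>; the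
    supremum term is the same on both sides and cancels.\<close>
  have "0 < 288 / pi * (pi * ln 2 / 16) powr (?s / (2 * real \<kappa>)) * \<sigma>\<^sup>2
            * (?s\<^sup>2 / (?s - 1)) powr (?s / (2 * real \<kappa>))" (is "0 < ?c")
    using assms(1,2) by (intro mult_pos_pos) auto
  then have "?c * (1 + xi_total \<kappa> \<Sigma> \<xi>) < ?c * (1 + xi_total \<kappa> \<Sigma> \<eta>)"
    using assms(3) by (intro mult_strict_left_mono) auto
  then show ?thesis
    by (simp add: variance_factor_def Let_def)
qed

text \<open>A larger minimal deviation raises the exponent of a base at least 1 in the denominator.
  For \<open>k = 1\<close> or \<open>L = 0\<close> the two sides coincide, so strictness has to come
  from the variance term.\<close>

lemma bias_term_antimono:
  assumes "card \<Sigma> > 1" "k > 0" "\<And>j. j \<in> \<Sigma> \<Longrightarrow> \<eta> j \<le> \<xi> j"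
  shows "2 * real (card \<Sigma>) * L\<^sup>2
       / real k powr (0.75 / (real (card \<Sigma>) * ln 2) * (1 + Min (\<xi> ` \<Sigma>)))
    \<le> 2 * real (card \<Sigma>) * L\<^sup>2
       / real k powr (0.75 / (real (card \<Sigma>) * ln 2) * (1 + Min (\<eta> ` \<Sigma>)))"
proof -
  have fin: "finite \<Sigma>" and ne: "\<Sigma> \<noteq> {}"
    using assms(1) by (auto simp: card_ge_0_finite)
  have "Min (\<eta> ` \<Sigma>) \<le> \<xi> j" if "j \<in> \<Sigma>" for j
    using assms(3)[OF that] fin that by (meson Min_le finite_imageI imageI order_trans)
  then have "Min (\<eta> ` \<Sigma>) \<le> Min (\<xi> ` \<Sigma>)"
    using fin ne by (intro Min.boundedI) auto
  then have "real k powr (0.75 / (real (card \<Sigma>) * ln 2) * (1 + Min (\<eta> ` \<Sigma>)))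
      \<le> real k powr (0.75 / (real (card \<Sigma>) * ln 2) * (1 + Min (\<xi> ` \<Sigma>)))"
    using assms(2) by (intro powr_mono mult_left_mono) auto
  then show ?thesis
    using assms(2) by (intro divide_left_mono) auto
qed

theorem proposition1:
  fixes \<kappa> :: nat and \<Sigma> :: "nat set"
    and M :: "'w measure" and X :: "'w \<Rightarrow> nat \<Rightarrow> real" and Y :: "'w \<Rightarrow> real"
    and tf tfstar condvar :: "(nat \<Rightarrow> real) \<Rightarrow> real" and L \<sigma> :: real
    and k :: "nat \<Rightarrow> nat" and \<delta> :: "nat \<Rightarrow> nat \<Rightarrow> real"
  assumes "\<kappa> \<ge> 2" and "\<Sigma> \<subseteq> {1..\<kappa>}" and "card \<Sigma> > 1"
    and "prob_space M"
    and "X \<in> measurable M (\<Pi>\<^sub>M i\<in>{1..\<kappa>}. borel)"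
    and "distr M (\<Pi>\<^sub>M i\<in>{1..\<kappa>}. lborel) X = uniform_cube {1..\<kappa>}"
    and "Y \<in> borel_measurable M" and "integrable M (\<lambda>\<omega>. (Y \<omega>)\<^sup>2)"
    and "cond_exp_version M {1..\<kappa>} X Y tf"
    and "cube_lipschitz L \<Sigma> tfstar"
    and "AE x in uniform_cube {1..\<kappa>}. tf x = tfstar (restrict x \<Sigma>)"
    and "bounded (tf ` unit_cube {1..\<kappa>})"
    and "\<sigma>\<^sup>2 > 0"
    and "cond_exp_version M {1..\<kappa>} X (\<lambda>\<omega>. (Y \<omega> - tf (X \<omega>))\<^sup>2) condvar"
    and "\<forall>x\<in>unit_cube {1..\<kappa>}. condvar x \<le> \<sigma>\<^sup>2"
    and "\<forall>n\<ge>1. k n > 0"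
    and "filterlim k at_top sequentially"
    and "(\<lambda>n. real (k n) / real n) \<longlonglongrightarrow> 0"
    and "\<forall>n\<ge>1. (\<Sum>j\<in>\<Sigma>. \<delta> n j) \<le> real \<kappa>"
    and "\<forall>n\<ge>1. \<forall>j\<in>\<Sigma>. 1 < \<delta> n j \<and> \<delta> n j < real \<kappa> / 2"
  shows "\<forall>n\<ge>1.
    mse_bound \<kappa> \<Sigma> \<sigma> L tf (k n) n (deviation \<Sigma> (targeted_sampling \<kappa> \<Sigma> (\<delta> n)))
    < mse_bound \<kappa> \<Sigma> \<sigma> L tf (k n) n (deviation \<Sigma> (uniform_sampling \<kappa>))"
proof (intro allI impI)
  fix n :: nat
  assume n: "n \<ge> 1"
  let ?ts = "targeted_sampling \<kappa> \<Sigma> (\<delta> n)" and ?us = "uniform_sampling \<kappa>"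
  have \<delta>: "1 < \<delta> n j \<and> \<delta> n j < real \<kappa> / 2" if "j \<in> \<Sigma>" for j
    using assms(20) n that by blast
  \<comment> \<open>Dividing \<open>1 < \<delta> n j < \<kappa> / 2\<close> by
    \<open>\<kappa>\<close> gives both upper comparisons.\<close>
  have p: "0 < ?us j \<and> ?us j < ?ts j \<and> ?ts j \<le> 1/2" if "j \<in> \<Sigma>" for j
    using \<delta>[OF that] that \<open>\<kappa> \<ge> 2\<close>
    by (auto simp: uniform_sampling_def targeted_sampling_def field_simps)
  have k: "k n > 0"
    using assms(16) n by blast
  have "variance_factor \<kappa> \<Sigma> \<sigma> tf (deviation \<Sigma> ?ts) < variance_factor \<kappa> \<Sigma> \<sigma> tf (deviation \<Sigma> ?us)"
    using assms p by (intro variance_factor_strict_mono xi_total_strict_antimono) auto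
  then have "variance_factor \<kappa> \<Sigma> \<sigma> tf (deviation \<Sigma> ?ts) * (real (k n) / real n)
      < variance_factor \<kappa> \<Sigma> \<sigma> tf (deviation \<Sigma> ?us) * (real (k n) / real n)"
    using n k by (intro mult_strict_right_mono) auto
  \<comment> \<open>The deviation is affine in the selection probability with slope
    \<open>card \<Sigma>\<close>, so it inherits the order.\<close>
  moreover have "deviation \<Sigma> ?us j \<le> deviation \<Sigma> ?ts j" if "j \<in> \<Sigma>" for j
    using p[OF that] by (auto simp: deviation_def intro!: mult_left_mono)
  ultimately show "mse_bound \<kappa> \<Sigma> \<sigma> L tf (k n) n (deviation \<Sigma> ?ts)
      < mse_bound \<kappa> \<Sigma> \<sigma> L tf (k n) n (deviation \<Sigma> ?us)"
    unfolding mse_bound_def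
    using assms(3) k by (intro add_less_le_mono bias_term_antimono)
qed

end
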